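(* Let $U=U_1\times\cdots\times U_m$ be a Cartesian product of nonempty finite sets. Every ample set $S\subseteq U$ is isometric.
   Context: $S\subseteq U$ is isometric if any $u,v\in S$ are joined by a path inside $S$ in the Hamming graph of $U$ (two tuples are adjacent iff they differ in exactly one coordinate) of length equal to the number of coordinates in which $u$ and $v$ differ. A generalized partition of $U$ is a tuple $\Lambda=(\alpha_1,\dots,\alpha_m)$ with $\alpha_i$ a partition of $U_i$ into nonempty blocks; it defines a partition of $U$ into the boxes $P^1\times\cdots\times P^m$, $P^i\in\alpha_i$, and the minor-subproduct $M(\Lambda)=M_1\times\cdots\times M_m$, where $M_i$ is the set of blocks of $\alpha_i$. $M(\Lambda)$ is shattered by $S\subseteq U$ if $S$ meets every box of the box-partition. A copy of $M(\Lambda)$ is a set $W_1\times\cdots\times W_m$ where $W_i$ consists of exactly one element from each block of $\alpha_i$. $M(\Lambda)$ is strongly shattered by $S$ if $S$ contains a copy of it. $S$ is ample if every minor-subproduct of $U$ shattered by $S$ is strongly shattered by $S$. *)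

theory Defs
  imports "HOL-Library.FuncSet" "HOL-Library.Disjoint_Sets"
begin

text \<open>
  The factors $U_1, \dots, U_m$ are given by a family \<open>U :: nat \<Rightarrow> 'a set\<close>, of which only the values
  at \<open>{1..m}\<close> matter. Tuples are extensional functions, so that equality of tuples is equality
  of their \<open>m\<close> coordinates.
\<close>

definition cart_prod :: "nat \<Rightarrow> (nat \<Rightarrow> 'a set) \<Rightarrow> (nat \<Rightarrow> 'a) set" where
  "cart_prod m U = (\<Pi>\<^sub>E i\<in>{1..m}. U i)"

definition hamming_dist :: "nat \<Rightarrow> (nat \<Rightarrow> 'a) \<Rightarrow> (nat \<Rightarrow> 'a) \<Rightarrow> nat" where
  "hamming_dist m u v = card {i \<in> {1..m}. u i \<noteq> v i}"

definition hamming_adj :: "nat \<Rightarrow> (nat \<Rightarrow> 'a) \<Rightarrow> (nat \<Rightarrow> 'a) \<Rightarrow> bool" where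
  "hamming_adj m u v \<longleftrightarrow> hamming_dist m u v = 1"

text \<open>A path is the list of its vertices; its length is the number of edges.\<close>

definition hamming_path_in ::
  "nat \<Rightarrow> (nat \<Rightarrow> 'a) set \<Rightarrow> (nat \<Rightarrow> 'a) \<Rightarrow> (nat \<Rightarrow> 'a) \<Rightarrow> (nat \<Rightarrow> 'a) list \<Rightarrow> bool" where
  "hamming_path_in m S u v p \<longleftrightarrow>
     p \<noteq> [] \<and> hd p = u \<and> last p = v \<and> set p \<subseteq> S \<and> distinct p \<and> successively (hamming_adj m) p"

definition isometric :: "nat \<Rightarrow> (nat \<Rightarrow> 'a) set \<Rightarrow> bool" where
  "isometric m S \<longleftrightarrow>
     (\<forall>u\<in>S. \<forall>v\<in>S. \<exists>p. hamming_path_in m S u v p \<and> length p - 1 = hamming_dist m u v)"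

definition generalized_partition :: "nat \<Rightarrow> (nat \<Rightarrow> 'a set) \<Rightarrow> (nat \<Rightarrow> 'a set set) \<Rightarrow> bool" where
  "generalized_partition m U \<Lambda> \<longleftrightarrow> (\<forall>i\<in>{1..m}. partition_on (U i) (\<Lambda> i))"

text \<open>
  Elements of the minor-subproduct are tuples of blocks; the box of such a tuple \<open>P\<close>
  is \<open>cart_prod m P\<close>.
\<close>

definition minor_subproduct :: "nat \<Rightarrow> (nat \<Rightarrow> 'a set set) \<Rightarrow> (nat \<Rightarrow> 'a set) set" where
  "minor_subproduct m \<Lambda> = cart_prod m \<Lambda>"

definition shattered :: "nat \<Rightarrow> (nat \<Rightarrow> 'a set set) \<Rightarrow> (nat \<Rightarrow> 'a) set \<Rightarrow> bool" where
  "shattered m \<Lambda> S \<longleftrightarrow> (\<forall>P\<in>minor_subproduct m \<Lambda>. S \<inter> cart_prod m P \<noteq> {})"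

definition is_copy :: "nat \<Rightarrow> (nat \<Rightarrow> 'a set set) \<Rightarrow> (nat \<Rightarrow> 'a) set \<Rightarrow> bool" where
  "is_copy m \<Lambda> C \<longleftrightarrow>
     (\<exists>W. (\<forall>i\<in>{1..m}. W i \<subseteq> \<Union>(\<Lambda> i) \<and> (\<forall>B\<in>\<Lambda> i. \<exists>!x. x \<in> W i \<inter> B)) \<and> C = cart_prod m W)"

definition strongly_shattered :: "nat \<Rightarrow> (nat \<Rightarrow> 'a set set) \<Rightarrow> (nat \<Rightarrow> 'a) set \<Rightarrow> bool" where
  "strongly_shattered m \<Lambda> S \<longleftrightarrow> (\<exists>C. is_copy m \<Lambda> C \<and> C \<subseteq> S)"

definition ample :: "nat \<Rightarrow> (nat \<Rightarrow> 'a set) \<Rightarrow> (nat \<Rightarrow> 'a) set \<Rightarrow> bool" where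
  "ample m U S \<longleftrightarrow>
     (\<forall>\<Lambda>. generalized_partition m U \<Lambda> \<longrightarrow> shattered m \<Lambda> S \<longrightarrow> strongly_shattered m \<Lambda> S)"

end

theory Submission
  imports Defs
begin

text \<open>
  Ampleness is inherited by restricting one factor \<open>U e\<close> to a nonempty subset \<open>A\<close>. Given a shattered
  partition of the restricted product, first merge \<open>C = U e - A\<close> into a block \<open>B\<^sub>0\<close> of \<open>A\<close>. If the
  resulting copy represents \<open>B\<^sub>0 \<union> C\<close> by an element of \<open>B\<^sub>0\<close>, it lies in the restricted set. Otherwise
  the copy witnesses that the partition with \<open>C\<close> as an additional block is shattered, and a copy
  for that partition restricts to \<open>A\<close>.

  Hence the trace of \<open>S\<close> on the box spanned by \<open>u, v \<in> S\<close> is ample. Splitting a single coordinate in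
  which \<open>u\<close> and \<open>v\<close> differ yields two adjacent points of \<open>S\<close> in this box, so if \<open>u\<close> and \<open>v\<close> are not
  adjacent then the box contains a third point of \<open>S\<close>. A point of \<open>S\<close> in the box other than \<open>u\<close> and
  nearest to \<open>u\<close> is therefore a neighbour of \<open>u\<close>.
\<close>

text \<open>Keeps \<open>{1..m}\<close> and distance 1 in the form in which they are stated, and
  \<open>i \<in> {1..m}\<close> as one premise.\<close>

declare One_nat_def [simp del] atLeastAtMost_iff [simp del]

text \<open>Only the factors are recorded. For \<open>u\<close> and \<open>v\<close> in a common
  product, \<open>cart_prod m (hamming_box u v)\<close> is the Hamming interval between them, the
  union of their geodesics.\<close>

definition hamming_box :: "(nat \<Rightarrow> 'a) \<Rightarrow> (nat \<Rightarrow> 'a) \<Rightarrow> nat \<Rightarrow> 'a set" where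
  "hamming_box u v i = {u i, v i}"

section \<open>Shattering and copies in coordinates\<close>

lemma cart_prod_iff:
  "x \<in> cart_prod m U \<longleftrightarrow> (\<forall>i\<in>{1..m}. x i \<in> U i) \<and> x \<in> extensional {1..m}"
  by (auto simp: cart_prod_def PiE_def Pi_def)

lemma ampleD:
  assumes "ample m U S" "generalized_partition m U \<Lambda>" "shattered m \<Lambda> S"
  shows "\<exists>W. (\<forall>i\<in>{1..m}. W i \<subseteq> U i \<and> (\<forall>B\<in>\<Lambda> i. \<exists>!x. x \<in> W i \<inter> B)) \<and> cart_prod m W \<subseteq> S"
proof -
  have "strongly_shattered m \<Lambda> S" using assms by (simp add: ample_def)
  then obtain W where "\<forall>i\<in>{1..m}. W i \<subseteq> \<Union>(\<Lambda> i) \<and> (\<forall>B\<in>\<Lambda> i. \<exists>!x. x \<in> W i \<inter> B)"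
    and "cart_prod m W \<subseteq> S"
    unfolding strongly_shattered_def is_copy_def by (elim exE conjE) simp
  moreover have "\<Union>(\<Lambda> i) = U i" if "i \<in> {1..m}" for i
    using assms(2) that by (auto simp: generalized_partition_def partition_on_def)
  ultimately show ?thesis by (intro exI[of _ W]) simp
qed

lemma strongly_shatteredI:
  assumes "\<And>i. i \<in> {1..m} \<Longrightarrow> W i \<subseteq> \<Union>(\<Lambda> i)"
    and "\<And>i B. i \<in> {1..m} \<Longrightarrow> B \<in> \<Lambda> i \<Longrightarrow> \<exists>!x. x \<in> W i \<inter> B"
    and "cart_prod m W \<subseteq> S"
  shows "strongly_shattered m \<Lambda> S"
proof -
  have "is_copy m \<Lambda> (cart_prod m W)"
    unfolding is_copy_def by (intro exI[of _ W] conjI ballI assms(1,2) refl)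
  then show ?thesis using assms(3) unfolding strongly_shattered_def by (intro exI conjI)
qed

text \<open>Boxes are indexed by extensional tuples of blocks; restricting \<open>P\<close> to
  \<open>{1..m}\<close> makes any choice of blocks admissible.\<close>

lemma shatteredD:
  assumes "shattered m \<Lambda> S" "\<And>i. i \<in> {1..m} \<Longrightarrow> P i \<in> \<Lambda> i"
  shows "\<exists>x\<in>S. \<forall>i\<in>{1..m}. x i \<in> P i"
proof -
  have "restrict P {1..m} \<in> minor_subproduct m \<Lambda>"
    using assms(2) by (auto simp: minor_subproduct_def cart_prod_iff)
  then obtain x where "x \<in> S" "x \<in> cart_prod m (restrict P {1..m})"
    using assms(1) unfolding shattered_def by blast
  then show ?thesis by (intro bexI[of _ x]) (auto simp: cart_prod_iff)
qed

text \<open>The inclusion in a product makes the points of \<open>S\<close> extensional, so lying in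
  a box can be checked coordinatewise.\<close>

lemma shatteredI:
  assumes "S \<subseteq> cart_prod m U"
    and "\<And>P. (\<And>i. i \<in> {1..m} \<Longrightarrow> P i \<in> \<Lambda> i) \<Longrightarrow> \<exists>x\<in>S. \<forall>i\<in>{1..m}. x i \<in> P i"
  shows "shattered m \<Lambda> S"
  unfolding shattered_def
proof
  fix P assume "P \<in> minor_subproduct m \<Lambda>"
  then have "\<And>i. i \<in> {1..m} \<Longrightarrow> P i \<in> \<Lambda> i"
    by (auto simp: minor_subproduct_def cart_prod_iff)
  then obtain x where "x \<in> S" "\<forall>i\<in>{1..m}. x i \<in> P i"
    using assms(2) by blast
  then show "S \<inter> cart_prod m P \<noteq> {}"
    using assms(1) cart_prod_iff[of x] by (metis disjoint_iff subsetD)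
qed

section \<open>Ampleness under restriction of factors\<close>

lemma ample_restrict_factor:
  assumes amp: "ample m U S" and S: "S \<subseteq> cart_prod m U"
    and e: "e \<in> {1..m}" and A: "A \<subseteq> U e" "A \<noteq> {}"
  shows "ample m (U(e := A)) (S \<inter> {x. x e \<in> A})"
  unfolding ample_def
proof (intro allI impI)
  fix \<Lambda>
  let ?S = "S \<inter> {x. x e \<in> A}"
  assume gp: "generalized_partition m (U(e := A)) \<Lambda>" and sh: "shattered m \<Lambda> ?S"
  have part: "partition_on (U i) (\<Lambda> i)" if "i \<in> {1..m}" "i \<noteq> e" for i
    using gp[unfolded generalized_partition_def, rule_format, OF that(1)] that(2) by simp
  have partU: "\<Union>(\<Lambda> i) = U i" if "i \<in> {1..m}" "i \<noteq> e" for i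
    using part[OF that] by (simp add: partition_on_def)
  have parte: "partition_on A (\<Lambda> e)"
    using gp e by (metis fun_upd_same generalized_partition_def)
  then have UA: "\<Union>(\<Lambda> e) = A" and disj: "disjoint (\<Lambda> e)" and ne: "{} \<notin> \<Lambda> e"
    by (auto simp: partition_on_def)
  obtain B0 where B0: "B0 \<in> \<Lambda> e" using A(2) UA by auto
  have B0A: "B0 \<subseteq> A" using B0 UA by auto
  \<comment> \<open>\<open>C\<close> may be empty; the merged block is then \<open>B0\<close>, and
    only the case \<open>c \<in> B0\<close> below can occur.\<close>
  define C where "C = U e - A"
  have disjB0: "disjnt B0 (\<Union>(\<Lambda> e - {B0}))"
    using disj B0 by (auto simp: disjoint_def disjnt_def)
  define \<Lambda>1 where "\<Lambda>1 = \<Lambda>(e := insert (B0 \<union> C) (\<Lambda> e - {B0}))"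
  have "partition_on (U e) (insert (B0 \<union> C) (\<Lambda> e - {B0}))"
  proof -
    have "partition_on (A - B0) (\<Lambda> e - {B0})"
      using parte B0 partition_on_insert[OF disjB0] by (metis insert_Diff)
    moreover have "A - B0 = U e - (B0 \<union> C)" using A(1) unfolding C_def by blast
    moreover have "disjnt (B0 \<union> C) (\<Union>(\<Lambda> e - {B0}))"
      using calculation(1,2) by (auto simp: partition_on_def disjnt_def)
    moreover have "B0 \<union> C \<subseteq> U e" using B0A A(1) by (auto simp: C_def)
    moreover have "B0 \<union> C \<noteq> {}" using B0 ne by auto
    ultimately show ?thesis by (simp add: partition_on_insert)
  qed
  then have gp1: "generalized_partition m U \<Lambda>1"
    using part by (auto simp: generalized_partition_def \<Lambda>1_def)
  have sh1: "shattered m \<Lambda>1 S"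
  proof (rule shatteredI[OF S])
    fix P assume P: "\<And>i. i \<in> {1..m} \<Longrightarrow> P i \<in> \<Lambda>1 i"
    \<comment> \<open>Shrinking the merged block back to \<open>B0\<close> gives a box of the given
      partition inside the box of \<open>P\<close>.\<close>
    define Q where "Q = (if P e = B0 \<union> C then P(e := B0) else P)"
    have "Q i \<in> \<Lambda> i" if "i \<in> {1..m}" for i
      using P[OF that] B0 unfolding Q_def \<Lambda>1_def by (cases "i = e") auto
    then obtain x where "x \<in> ?S" "\<forall>i\<in>{1..m}. x i \<in> Q i"
      using shatteredD[OF sh] by blast
    moreover have "Q i \<subseteq> P i" for i by (auto simp: Q_def)
    ultimately show "\<exists>x\<in>S. \<forall>i\<in>{1..m}. x i \<in> P i" by blast
  qed
  obtain W where W: "\<forall>i\<in>{1..m}. W i \<subseteq> U i \<and> (\<forall>B\<in>\<Lambda>1 i. \<exists>!x. x \<in> W i \<inter> B)"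
    and WS: "cart_prod m W \<subseteq> S"
    using ampleD[OF amp gp1 sh1] by (elim exE conjE) simp
  have WU: "W i \<subseteq> U i" if "i \<in> {1..m}" for i
    by (rule conjunct1[OF bspec[OF W that]])
  have W1: "\<exists>!x. x \<in> W i \<inter> B" if "i \<in> {1..m}" "B \<in> \<Lambda>1 i" for i B
    by (rule bspec[OF conjunct2[OF bspec[OF W that(1)]] that(2)])
  have "\<exists>!x. x \<in> W e \<inter> (B0 \<union> C)"
    by (rule W1[OF e]) (simp add: \<Lambda>1_def)
  then obtain c where c: "c \<in> W e" "c \<in> B0 \<union> C"
    and cu: "\<forall>x. x \<in> W e \<inter> (B0 \<union> C) \<longrightarrow> x = c" unfolding Ex1_def Int_iff by blast
  have Wother: "\<exists>!x. x \<in> W i \<inter> B" if "i \<in> {1..m}" "i \<noteq> e" "B \<in> \<Lambda> i" for i B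
    by (rule W1[OF that(1)]) (simp add: \<Lambda>1_def that)
  show "strongly_shattered m \<Lambda> ?S"
  proof (cases "c \<in> B0")
    case True
    \<comment> \<open>All of \<open>C\<close> lies in the merged block, whose only point in
      \<open>W e\<close> is \<open>c\<close>; so \<open>W e\<close> avoids \<open>C\<close>.\<close>
    have WA: "W e \<subseteq> A"
      using cu True B0A WU[OF e] unfolding C_def by auto
    show ?thesis
    proof (rule strongly_shatteredI)
      show "W i \<subseteq> \<Union>(\<Lambda> i)" if "i \<in> {1..m}" for i
        using WA UA partU[OF that] WU[OF that] by (cases "i = e") simp_all
      show "\<exists>!x. x \<in> W i \<inter> B" if i: "i \<in> {1..m}" and B: "B \<in> \<Lambda> i" for i B
      proof (cases "i = e")
        case ie: True
        show ?thesis
        proof (cases "B = B0")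
          case True
          then show ?thesis using \<open>c \<in> B0\<close> c(1) cu ie by (intro ex1I[of _ c]) simp_all
        next
          case False
          then show ?thesis using B ie by (intro W1[OF i]) (simp add: \<Lambda>1_def)
        qed
      qed (rule Wother[OF i _ B])
      show "cart_prod m W \<subseteq> ?S"
        using WS WA e by (auto simp: cart_prod_iff)
    qed
  next
    case False
    then have cC: "c \<in> C" using c by auto
    define \<Lambda>2 where "\<Lambda>2 = \<Lambda>(e := insert C (\<Lambda> e))"
    have "partition_on (U e) (insert C (\<Lambda> e))"
    proof -
      have "disjnt C (\<Union>(\<Lambda> e))" using UA by (auto simp: C_def disjnt_def)
      moreover have "U e - C = A" using A(1) unfolding C_def by blast
      moreover have "C \<subseteq> U e" by (auto simp: C_def)
      ultimately show ?thesis using parte cC by (auto simp: partition_on_insert)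
    qed
    then have gp2: "generalized_partition m U \<Lambda>2"
      using part by (auto simp: generalized_partition_def \<Lambda>2_def)
    have sh2: "shattered m \<Lambda>2 S"
    proof (rule shatteredI[OF S])
      fix P assume P: "\<And>i. i \<in> {1..m} \<Longrightarrow> P i \<in> \<Lambda>2 i"
      show "\<exists>x\<in>S. \<forall>i\<in>{1..m}. x i \<in> P i"
      proof (cases "P e = C")
        case True
        \<comment> \<open>The point hitting this box is taken from the first copy: \<open>c\<close>
          at \<open>e\<close>, and the representative of \<open>P i\<close> in \<open>W i\<close>
          elsewhere.\<close>
        have "\<exists>x. x \<in> W i \<inter> P i" if "i \<in> {1..m}" for i
        proof (cases "i = e")
          case ie: True
          then show ?thesis using True c(1) cC by (intro exI[of _ c]) simp
        next
          case False
          then have "P i \<in> \<Lambda> i" using P[OF that] by (simp add: \<Lambda>2_def)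
          then show ?thesis using ex1_implies_ex[OF Wother[OF that False]] by simp
        qed
        then obtain f where f: "\<And>i. i \<in> {1..m} \<Longrightarrow> f i \<in> W i \<inter> P i" by metis
        then have "restrict f {1..m} \<in> cart_prod m W" by (auto simp: cart_prod_iff)
        then have "restrict f {1..m} \<in> S" using WS by blast
        then show ?thesis using f by (intro bexI[of _ "restrict f {1..m}"]) auto
      next
        case False
        have "P i \<in> \<Lambda> i" if "i \<in> {1..m}" for i
          using P[OF that] False by (cases "i = e") (auto simp: \<Lambda>2_def)
        then show ?thesis using shatteredD[OF sh, of P] by blast
      qed
    qed
    obtain V where V2: "\<forall>i\<in>{1..m}. V i \<subseteq> U i \<and> (\<forall>B\<in>\<Lambda>2 i. \<exists>!x. x \<in> V i \<inter> B)"
      and VS: "cart_prod m V \<subseteq> S"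
      using ampleD[OF amp gp2 sh2] by (elim exE conjE) simp
    have VU: "V i \<subseteq> U i" if "i \<in> {1..m}" for i
      by (rule conjunct1[OF bspec[OF V2 that]])
    have V: "\<exists>!x. x \<in> V i \<inter> B" if "i \<in> {1..m}" "B \<in> \<Lambda> i" for i B
    proof -
      have "B \<in> \<Lambda>2 i" using that(2) by (auto simp: \<Lambda>2_def)
      then show ?thesis by (rule bspec[OF conjunct2[OF bspec[OF V2 that(1)]]])
    qed
    show ?thesis
    \<comment> \<open>Intersecting with \<open>A\<close> discards the representative of
      \<open>C\<close> and keeps those of the blocks in \<open>\<Lambda> e\<close>, which lie in
      \<open>A\<close>.\<close>
    proof (rule strongly_shatteredI[where W = "V(e := V e \<inter> A)"])
      show "(V(e := V e \<inter> A)) i \<subseteq> \<Union>(\<Lambda> i)" if "i \<in> {1..m}" for i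
        using UA partU[OF that] VU[OF that] by (cases "i = e") simp_all
      show "\<exists>!x. x \<in> (V(e := V e \<inter> A)) i \<inter> B" if i: "i \<in> {1..m}" and B: "B \<in> \<Lambda> i" for i B
      proof (cases "i = e")
        case True
        then have "V e \<inter> A \<inter> B = V e \<inter> B" using B UA by blast
        then show ?thesis using V[OF i B] True by simp
      qed (use V[OF i B] in simp)
      show "cart_prod m (V(e := V e \<inter> A)) \<subseteq> ?S"
      proof
        fix x assume "x \<in> cart_prod m (V(e := V e \<inter> A))"
        then have x: "\<And>i. i \<in> {1..m} \<Longrightarrow> x i \<in> (V(e := V e \<inter> A)) i"
          and ext: "x \<in> extensional {1..m}" by (auto simp: cart_prod_iff)
        have "x i \<in> V i" if "i \<in> {1..m}" for i
          using x[OF that] by (cases "i = e") auto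
        then have "x \<in> cart_prod m V" using ext by (simp add: cart_prod_iff)
        then show "x \<in> ?S" using VS x[OF e] by auto
      qed
    qed
  qed
qed

lemma ample_cong:
  assumes "\<And>i. i \<in> {1..m} \<Longrightarrow> U i = V i"
  shows "ample m U S = ample m V S"
  using assms by (simp add: ample_def generalized_partition_def)

lemma ample_restrict:
  assumes amp: "ample m U S" and S: "S \<subseteq> cart_prod m U"
    and V: "\<And>i. i \<in> {1..m} \<Longrightarrow> V i \<subseteq> U i" "\<And>i. i \<in> {1..m} \<Longrightarrow> V i \<noteq> {}"
  shows "ample m V (S \<inter> cart_prod m V)"
proof -
  \<comment> \<open>Factors are restricted one at a time; \<open>I\<close> holds the coordinates
    already treated.\<close>
  have "ample m (\<lambda>i. if i \<in> I then V i else U i) (S \<inter> {x. \<forall>i\<in>I. x i \<in> V i})"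
    if "finite I" "I \<subseteq> {1..m}" for I
    using that
  proof (induction I)
    case empty
    then show ?case using amp by simp
  next
    case (insert e I)
    let ?U = "\<lambda>i. if i \<in> I then V i else U i" and ?S = "S \<inter> {x. \<forall>i\<in>I. x i \<in> V i}"
    have "?S \<subseteq> cart_prod m ?U" using S by (auto simp: cart_prod_iff)
    then have "ample m (?U(e := V e)) (?S \<inter> {x. x e \<in> V e})"
      using insert V by (intro ample_restrict_factor) auto
    moreover have "?U(e := V e) = (\<lambda>i. if i \<in> insert e I then V i else U i)"
      by (rule ext) simp
    moreover have "?S \<inter> {x. x e \<in> V e} = S \<inter> {x. \<forall>i\<in>insert e I. x i \<in> V i}" by auto
    ultimately show ?case by simp
  qed
  then have "ample m (\<lambda>i. if i \<in> {1..m} then V i else U i) (S \<inter> {x. \<forall>i\<in>{1..m}. x i \<in> V i})"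
    by blast
  moreover have "S \<inter> {x. \<forall>i\<in>{1..m}. x i \<in> V i} = S \<inter> cart_prod m V"
    using S by (auto simp: cart_prod_iff)
  ultimately show ?thesis
    using ample_cong[of m V "\<lambda>i. if i \<in> {1..m} then V i else U i"] by simp
qed

section \<open>Boxes and Hamming distance\<close>

lemma cart_prod_boxD:
  assumes "x \<in> cart_prod m (hamming_box u v)" "i \<in> {1..m}"
  shows "x i = u i \<or> x i = v i"
  using assms unfolding cart_prod_iff hamming_box_def by blast

text \<open>Convexity of boxes; it carries points found in a smaller box back to the original
  one.\<close>

lemma cart_prod_box_mono:
  assumes "x \<in> cart_prod m (hamming_box u v)" "y \<in> cart_prod m (hamming_box u v)"
  shows "cart_prod m (hamming_box x y) \<subseteq> cart_prod m (hamming_box u v)"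
  using assms unfolding cart_prod_def hamming_box_def by (intro PiE_mono) (auto simp: PiE_iff)

lemma endpoints_in_box:
  assumes "u \<in> cart_prod m U" "v \<in> cart_prod m U"
  shows "u \<in> cart_prod m (hamming_box u v)" "v \<in> cart_prod m (hamming_box u v)"
  using assms unfolding cart_prod_iff hamming_box_def by blast+

lemma hamming_dist_eq_0:
  assumes "u \<in> cart_prod m U" "v \<in> cart_prod m U"
  shows "hamming_dist m u v = 0 \<longleftrightarrow> u = v"
proof -
  have "u = v" if "\<And>i. i \<in> {1..m} \<Longrightarrow> u i = v i"
    using assms that unfolding cart_prod_iff by (intro extensionalityI[of u "{1..m}" v]) blast+
  then show ?thesis by (auto simp: hamming_dist_def)
qed

text \<open>Each coordinate of \<open>w\<close> agrees with \<open>u\<close> or \<open>v\<close>, so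
  a coordinate separating \<open>u\<close> from \<open>v\<close> separates \<open>w\<close> from
  exactly one of them.\<close>

lemma hamming_dist_box:
  assumes "w \<in> cart_prod m (hamming_box u v)"
  shows "hamming_dist m u v = hamming_dist m u w + hamming_dist m w v"
proof -
  have "{i \<in> {1..m}. u i \<noteq> v i} = {i \<in> {1..m}. u i \<noteq> w i} \<union> {i \<in> {1..m}. w i \<noteq> v i}"
    using cart_prod_boxD[OF assms] by fastforce
  moreover have "{i \<in> {1..m}. u i \<noteq> w i} \<inter> {i \<in> {1..m}. w i \<noteq> v i} = {}"
    using cart_prod_boxD[OF assms] by fastforce
  ultimately show ?thesis by (simp add: hamming_dist_def card_Un_disjoint)
qed

section \<open>Neighbours and geodesics inside a box\<close>

lemma ample_adjacent_in_box:
  assumes amp: "ample m U S" and S: "S \<subseteq> cart_prod m U"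
    and uv: "u \<in> S" "v \<in> S" "u \<noteq> v"
  shows "\<exists>x \<in> S \<inter> cart_prod m (hamming_box u v). \<exists>y \<in> S \<inter> cart_prod m (hamming_box u v).
    hamming_dist m x y = 1"
proof -
  let ?V = "hamming_box u v"
  let ?S = "S \<inter> cart_prod m ?V"
  have uU: "u \<in> cart_prod m U" and vU: "v \<in> cart_prod m U" using S uv by auto
  have "{i \<in> {1..m}. u i \<noteq> v i} \<noteq> {}"
    using hamming_dist_eq_0[OF uU vU] uv(3) unfolding hamming_dist_def by (metis card.empty)
  then obtain e where e: "e \<in> {1..m}" "u e \<noteq> v e" by blast
  have ampV: "ample m ?V ?S"
    by (rule ample_restrict[OF amp S]) (use uU vU in \<open>auto simp: cart_prod_iff hamming_box_def\<close>)
  \<comment> \<open>There are just two boxes, one containing \<open>u\<close> and the other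
    \<open>v\<close>. A copy has two values at \<open>e\<close> and one at every other coordinate,
    so it is an edge in direction \<open>e\<close>.\<close>
  define \<Lambda> where "\<Lambda> = (\<lambda>i. if i = e then {{u e}, {v e}} else {{u i, v i}})"
  have gp: "generalized_partition m ?V \<Lambda>"
    using e by (auto simp: generalized_partition_def hamming_box_def \<Lambda>_def partition_on_def
        disjoint_def)
  have uV: "u \<in> ?S" and vV: "v \<in> ?S"
    using endpoints_in_box[OF uU vU] uv by blast+
  have sh: "shattered m \<Lambda> ?S"
  proof (rule shatteredI[where U = ?V])
    fix P assume P: "\<And>i. i \<in> {1..m} \<Longrightarrow> P i \<in> \<Lambda> i"
    have "P e = {u e} \<or> P e = {v e}" using P[OF e(1)] by (auto simp: \<Lambda>_def)
    moreover have "P i = {u i, v i}" if "i \<in> {1..m}" "i \<noteq> e" for i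
      using P[OF that(1)] that(2) by (simp add: \<Lambda>_def)
    ultimately have "\<exists>x\<in>{u, v}. \<forall>i\<in>{1..m}. x i \<in> P i"
      by (metis insertCI)
    then show "\<exists>x\<in>?S. \<forall>i\<in>{1..m}. x i \<in> P i" using uV vV by blast
  qed simp
  obtain W where W': "\<forall>i\<in>{1..m}. W i \<subseteq> ?V i \<and> (\<forall>B\<in>\<Lambda> i. \<exists>!x. x \<in> W i \<inter> B)"
    and WS: "cart_prod m W \<subseteq> ?S"
    using ampleD[OF ampV gp sh] by (elim exE conjE) simp
  have W: "\<exists>!x. x \<in> W i \<inter> B" if "i \<in> {1..m}" "B \<in> \<Lambda> i" for i B
    by (rule bspec[OF conjunct2[OF bspec[OF W' that(1)]] that(2)])
  have ue: "u e \<in> W e" and ve: "v e \<in> W e"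
    using W[OF e(1), of "{u e}", THEN ex1_implies_ex] W[OF e(1), of "{v e}", THEN ex1_implies_ex]
    by (auto simp: \<Lambda>_def)
  have "\<exists>a. a \<in> W i" if "i \<in> {1..m}" for i
    using W[OF that, of "{u i, v i}", THEN ex1_implies_ex] ue by (cases "i = e") (auto simp: \<Lambda>_def)
  then obtain f where f: "\<And>i. i \<in> {1..m} \<Longrightarrow> f i \<in> W i" by metis
  define x where "x = restrict (f(e := u e)) {1..m}"
  define y where "y = restrict (f(e := v e)) {1..m}"
  have "x \<in> cart_prod m W" "y \<in> cart_prod m W"
    using f ue ve by (auto simp: x_def y_def cart_prod_iff)
  moreover have "{i \<in> {1..m}. x i \<noteq> y i} = {e}"
    using e by (auto simp: x_def y_def)
  ultimately show ?thesis
    using WS by (intro bexI[of _ x] bexI[of _ y]) (auto simp: hamming_dist_def)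
qed

text \<open>The adjacent pair found in the box cannot lie within \<open>{u, v}\<close>: these two
  are not adjacent, and no point is adjacent to itself.\<close>

lemma ample_third_point_in_box:
  assumes "ample m U S" and S: "S \<subseteq> cart_prod m U"
    and uv: "u \<in> S" "v \<in> S" "u \<noteq> v" "hamming_dist m u v \<noteq> 1"
  shows "\<exists>w \<in> S \<inter> cart_prod m (hamming_box u v). w \<noteq> u \<and> w \<noteq> v"
proof -
  let ?S = "S \<inter> cart_prod m (hamming_box u v)"
  obtain x y where xy: "x \<in> ?S" "y \<in> ?S" "hamming_dist m x y = 1"
    using ample_adjacent_in_box[OF assms(1-5)] by blast
  have "{i \<in> {1..m}. v i \<noteq> u i} = {i \<in> {1..m}. u i \<noteq> v i}" by fastforce
  then have "hamming_dist m v u \<noteq> 1" using uv(4) unfolding hamming_dist_def by simp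
  moreover have "hamming_dist m w w \<noteq> 1" for w by (simp add: hamming_dist_def)
  ultimately have "\<not> {x, y} \<subseteq> {u, v}" using xy(3) uv(4) by auto
  then show ?thesis using xy(1,2) by blast
qed

lemma ample_neighbour_in_box:
  assumes "ample m U S" and S: "S \<subseteq> cart_prod m U"
    and "u \<in> S" "v \<in> S" "u \<noteq> v"
  shows "\<exists>w \<in> S \<inter> cart_prod m (hamming_box u v). hamming_dist m u w = 1"
  using assms(4,5)
\<comment> \<open>Descent plays the role of choosing a nearest point: a third point \<open>w\<close>
  of the box is strictly closer to \<open>u\<close> and replaces \<open>v\<close>.\<close>
proof (induction "hamming_dist m u v" arbitrary: v rule: less_induct)
  case less
  have vU: "v \<in> cart_prod m U" using less.prems S by auto
  show ?case
  proof (cases "hamming_dist m u v = 1")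
    case True
    then show ?thesis using less.prems(1) endpoints_in_box[of u m U v] assms(3) S vU by blast
  next
    case False
    obtain w where w: "w \<in> S \<inter> cart_prod m (hamming_box u v)" "w \<noteq> u" "w \<noteq> v"
      using ample_third_point_in_box[OF assms(1-3) less.prems False] by blast
    have "hamming_dist m w v \<noteq> 0" using w vU S hamming_dist_eq_0 by blast
    then have "hamming_dist m u w < hamming_dist m u v"
      using hamming_dist_box[of w m u v] w by auto
    then obtain z where z: "z \<in> S \<inter> cart_prod m (hamming_box u w)" "hamming_dist m u z = 1"
      using less.hyps[of w] w by auto
    have "u \<in> cart_prod m U" using assms(3) S by blast
    then have "z \<in> cart_prod m (hamming_box u v)"
      using cart_prod_box_mono[of u m u v w] endpoints_in_box[of u m U v] vU w(1) z(1) by blast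
    then show ?thesis using z by blast
  qed
qed

text \<open>Keeping the path inside the box makes it distinct: the coordinate changed first never
  changes back.\<close>

lemma ample_path_in_box:
  assumes "ample m U S" and S: "S \<subseteq> cart_prod m U" and "u \<in> S" "v \<in> S"
  shows "\<exists>p. hamming_path_in m (S \<inter> cart_prod m (hamming_box u v)) u v p \<and>
    length p = Suc (hamming_dist m u v)"
  using assms(3)
\<comment> \<open>The target \<open>v\<close> stays fixed while the start moves to a neighbour one
  step closer.\<close>
proof (induction "hamming_dist m u v" arbitrary: u rule: less_induct)
  case less
  have uU: "u \<in> cart_prod m U" and vU: "v \<in> cart_prod m U" using less.prems assms by auto
  have ubox: "u \<in> cart_prod m (hamming_box u v)"
    using endpoints_in_box[OF uU vU] by blast
  show ?case
  proof (cases "u = v")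
    case True
    then show ?thesis using less.prems ubox
      by (intro exI[of _ "[u]"]) (auto simp: hamming_path_in_def hamming_dist_def)
  next
    case False
    obtain w where w: "w \<in> S" "w \<in> cart_prod m (hamming_box u v)" "hamming_dist m u w = 1"
      using ample_neighbour_in_box[OF assms(1,2) less.prems assms(4) False] by blast
    have d: "hamming_dist m u v = Suc (hamming_dist m w v)"
      using hamming_dist_box[OF w(2)] w(3) by simp
    then obtain p where p: "hamming_path_in m (S \<inter> cart_prod m (hamming_box w v)) w v p"
      "length p = Suc (hamming_dist m w v)"
      using less.hyps[of w] w by auto
    have sub: "cart_prod m (hamming_box w v) \<subseteq> cart_prod m (hamming_box u v)"
      using cart_prod_box_mono[OF w(2)] endpoints_in_box[OF uU vU] by blast
    have "{i \<in> {1..m}. u i \<noteq> w i} \<noteq> {}"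
      using w(3) by (metis card.empty hamming_dist_def zero_neq_one)
    then obtain e where e: "e \<in> {1..m}" "u e \<noteq> w e" by auto
    then have "w e = v e" using cart_prod_boxD[OF w(2)] by metis
    then have "u \<notin> cart_prod m (hamming_box w v)"
      using e cart_prod_boxD[of u m w v e] by auto
    then have "hamming_path_in m (S \<inter> cart_prod m (hamming_box u v)) u v (u # p)"
      using p(1) sub ubox less.prems w(3)
      by (auto simp: hamming_path_in_def successively_Cons hamming_adj_def)
    then show ?thesis using p(2) d by (intro exI[of _ "u # p"]) simp
  qed
qed

theorem proposition2:
  fixes m :: nat and U :: "nat \<Rightarrow> 'a set" and S :: "(nat \<Rightarrow> 'a) set"
  assumes "\<And>i. i \<in> {1..m} \<Longrightarrow> finite (U i)"
    and "\<And>i. i \<in> {1..m} \<Longrightarrow> U i \<noteq> {}"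
    and "S \<subseteq> cart_prod m U"
    and "ample m U S"
  shows "isometric m S"
  unfolding isometric_def
proof (intro ballI)
  fix u v assume "u \<in> S" "v \<in> S"
  then obtain p where "hamming_path_in m (S \<inter> cart_prod m (hamming_box u v)) u v p"
    "length p = Suc (hamming_dist m u v)"
    using ample_path_in_box[OF assms(4,3)] by blast
  \<comment> \<open>A path has one more vertex than edges, so the truncated subtraction is
    exact.\<close>
  then show "\<exists>p. hamming_path_in m S u v p \<and> length p - 1 = hamming_dist m u v"
    by (auto simp: hamming_path_in_def)
qed

end
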